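(* If $T$ is a locally bounded operator on a sequentially complete locally convex space $X$, then the spectral set $\sigma(T)$ is a compact subset of $\mathbb{C}$.
   Context: All locally convex spaces are Hausdorff over $\mathbb{C}$ and all operators are linear. An operator $T:X\to X$ is locally bounded if it maps some zero neighborhood into a bounded set. The spectral set $\sigma(T)$ is the complement in $\mathbb{C}$ of $\rho(T)$, the set of $\lambda\in\mathbb{C}$ such that $\lambda I-T$ has a continuous linear inverse on $X$. *)

theory Defs
  imports "HOL-Analysis.Analysis"
begin

(* In this sort the uniformity is determined by the topology: by
   cauchy_seq_finset_iff_vanishing it is the preimage of the filter of zero neighborhoods
   under subtraction. Hence it adds no data, and Cauchy is the usual notion in a topological
   vector space, see Cauchy_iff_zero_neighborhoods. *)
locale locally_convex_space = vector_space smul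
  for smul :: "complex \<Rightarrow> 'a::{uniform_topological_group_add, ab_group_add, t2_space} \<Rightarrow> 'a" +
  assumes continuous_scale: "continuous_on UNIV (\<lambda>(c, x). smul c x)"
    and locally_convex:
      "\<And>U. open U \<Longrightarrow> 0 \<in> U \<Longrightarrow>
         \<exists>V. open V \<and> 0 \<in> V \<and> V \<subseteq> U \<and>
           (\<forall>x\<in>V. \<forall>y\<in>V. \<forall>u\<ge>0. \<forall>v\<ge>0. u + v = 1 \<longrightarrow>
              smul (complex_of_real u) x + smul (complex_of_real v) y \<in> V)"

locale sequentially_complete_lcs = locally_convex_space smul
  for smul :: "complex \<Rightarrow> 'a::{uniform_topological_group_add, ab_group_add, t2_space} \<Rightarrow> 'a" +
  assumes Cauchy_imp_convergent: "\<And>X :: nat \<Rightarrow> 'a. Cauchy X \<Longrightarrow> convergent X"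

lemma Cauchy_iff_zero_neighborhoods:
  fixes X :: "nat \<Rightarrow> 'a::{uniform_topological_group_add, ab_group_add}"
  shows "Cauchy X \<longleftrightarrow>
    (\<forall>U. open U \<and> 0 \<in> U \<longrightarrow> (\<exists>N. \<forall>n\<ge>N. \<forall>m\<ge>N. X m - X n \<in> U))"
  (is "_ \<longleftrightarrow> ?R")
proof
  assume L: "Cauchy X"
  show ?R
  proof (intro allI impI)
    fix U :: "'a set" assume "open U \<and> 0 \<in> U"
    then have "eventually (\<lambda>(x, y). y - x \<in> U) uniformity"
      unfolding cauchy_seq_finset_iff_vanishing eventually_filtercomap eventually_nhds
      by (intro exI[of _ "\<lambda>z. z \<in> U"]) auto
    with L show "\<exists>N. \<forall>n\<ge>N. \<forall>m\<ge>N. X m - X n \<in> U"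
      unfolding Cauchy_uniform_iff by fastforce
  qed
next
  assume R: ?R
  show "Cauchy X"
    unfolding Cauchy_uniform_iff
  proof (intro allI impI)
    fix P :: "'a \<times> 'a \<Rightarrow> bool" assume "eventually P uniformity"
    then obtain U where U: "open U" "0 \<in> U" "\<And>x y. y - x \<in> U \<Longrightarrow> P (x, y)"
      unfolding cauchy_seq_finset_iff_vanishing eventually_filtercomap eventually_nhds by fastforce
    with R obtain N where "\<forall>n\<ge>N. \<forall>m\<ge>N. X m - X n \<in> U" by blast
    with U show "\<exists>N. \<forall>n\<ge>N. \<forall>m\<ge>N. P (X n, X m)" by blast
  qed
qed

(* Von Neumann boundedness: absorbed by every zero neighborhood. *)
definition vn_bounded ::
    "(complex \<Rightarrow> 'a::{topological_space, zero} \<Rightarrow> 'a) \<Rightarrow> 'a set \<Rightarrow> bool" where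
  "vn_bounded smul B \<longleftrightarrow>
     (\<forall>V. open V \<and> 0 \<in> V \<longrightarrow> (\<exists>s>0. \<forall>t>s. B \<subseteq> smul (complex_of_real t) ` V))"

definition locally_bounded_op ::
    "(complex \<Rightarrow> 'a::{topological_space, zero} \<Rightarrow> 'a) \<Rightarrow> ('a \<Rightarrow> 'a) \<Rightarrow> bool" where
  "locally_bounded_op smul T \<longleftrightarrow>
     (\<exists>U B. open U \<and> 0 \<in> U \<and> vn_bounded smul B \<and> T ` U \<subseteq> B)"

definition resolvent_set ::
    "(complex \<Rightarrow> 'a::{topological_space, ab_group_add} \<Rightarrow> 'a) \<Rightarrow> ('a \<Rightarrow> 'a) \<Rightarrow> complex set" where
  "resolvent_set smul T =
     {l. \<exists>S. Vector_Spaces.linear smul smul S \<and> continuous_on UNIV S \<and>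
          (\<forall>x. S (smul l x - T x) = x) \<and> (\<forall>x. smul l (S x) - T (S x) = x)}"

definition spectral_set ::
    "(complex \<Rightarrow> 'a::{topological_space, ab_group_add} \<Rightarrow> 'a) \<Rightarrow> ('a \<Rightarrow> 'a) \<Rightarrow> complex set" where
  "spectral_set smul T = - resolvent_set smul T"

end

theory Submission
  imports Defs
begin

text \<open>
  A locally bounded \<open>T\<close> satisfies \<open>T ` U \<subseteq> B\<close> and \<open>B \<subseteq> M U\<close> for a zero neighborhood \<open>U\<close>, a bounded
  set \<open>B\<close> and some \<open>M > 0\<close>, so \<open>T ^ (n + 1)\<close> maps \<open>U\<close> into \<open>M ^ n B\<close>. By local convexity and sequential
  completeness the Neumann series of \<open>l I - T\<close> converges for \<open>\<bar>l\<bar> > M\<close>, uniformly on \<open>U\<close>; this makes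
  the spectrum bounded.

  For closedness, let \<open>R\<close> be the resolvent at \<open>l\<^sub>0\<close>. Although \<open>R\<close> need not be locally bounded,
  \<open>l I - T = (l\<^sub>0 I - T) (I + (l - l\<^sub>0) R)\<close>, and for \<open>l\<^sub>0 \<noteq> 0\<close> the identity \<open>l\<^sub>0 R = I + T R\<close> turns the
  second factor into a multiple of \<open>(l / (l - l\<^sub>0)) I + T R\<close>, where \<open>T R\<close> is locally bounded. If
  \<open>l\<^sub>0 = 0\<close>, then \<open>T\<close> is an isomorphism, \<open>X\<close> has a bounded zero neighborhood, and \<open>R\<close> is locally bounded.
\<close>

section \<open>Invertible operators and scalar multiplication\<close>

text \<open>Frees the condition in \<open>resolvent_set\<close> from the form
  \<open>l I - T\<close>, so that an operator can be factored and its factors inverted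
  separately.\<close>

definition continuously_invertible ::
    "(complex \<Rightarrow> 'a::{topological_space, ab_group_add} \<Rightarrow> 'a) \<Rightarrow> ('a \<Rightarrow> 'a) \<Rightarrow> bool" where
  "continuously_invertible smul F \<longleftrightarrow>
     (\<exists>S. Vector_Spaces.linear smul smul S \<and> continuous_on UNIV S \<and>
          (\<forall>x. S (F x) = x) \<and> (\<forall>x. F (S x) = x))"

lemma resolvent_set_iff:
  "l \<in> resolvent_set smul T \<longleftrightarrow> continuously_invertible smul (\<lambda>x. smul l x - T x)"
  by (simp add: resolvent_set_def continuously_invertible_def)

lemma continuously_invertible_compose:
  assumes "continuously_invertible smul F" "continuously_invertible smul G"
  shows "continuously_invertible smul (\<lambda>x. F (G x))"
proof -
  obtain R where R: "Vector_Spaces.linear smul smul R" "continuous_on UNIV R"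
      "\<And>x. R (F x) = x" "\<And>x. F (R x) = x"
    using assms(1) unfolding continuously_invertible_def by blast
  obtain S where S: "Vector_Spaces.linear smul smul S" "continuous_on UNIV S"
      "\<And>x. S (G x) = x" "\<And>x. G (S x) = x"
    using assms(2) unfolding continuously_invertible_def by blast
  have "Vector_Spaces.linear smul smul (S \<circ> R)"
    using R(1) S(1) by (rule Vector_Spaces.linear_compose)
  moreover have "continuous_on UNIV (S \<circ> R)"
    using R(2) S(2) by (metis continuous_on_compose continuous_on_subset subset_UNIV)
  ultimately show ?thesis
    unfolding continuously_invertible_def using R S by (intro exI[of _ "S \<circ> R"]) auto
qed

lemma vn_boundedE:
  assumes "vn_bounded smul B" "open V" "0 \<in> V"
  obtains t :: real where "t > 0" "B \<subseteq> smul (complex_of_real t) ` V"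
proof -
  obtain s where "s > 0" "\<forall>t>s. B \<subseteq> smul (complex_of_real t) ` V"
    using assms unfolding vn_bounded_def by blast
  then show thesis
    by (intro that[of "s + 1"]) (simp_all del: of_real_add)
qed

context locally_convex_space
begin

lemma linearI:
  assumes "\<And>x y. F (x + y) = F x + F y" "\<And>c x. F (smul c x) = smul c (F x)"
  shows "Vector_Spaces.linear smul smul F"
  using assms vector_space_axioms by (simp add: Vector_Spaces.linear_iff)

lemma tendsto_scale:
  assumes "(f \<longlongrightarrow> c) G" "(g \<longlongrightarrow> x) G"
  shows "((\<lambda>i. smul (f i) (g i)) \<longlongrightarrow> smul c x) G"
proof -
  have "isCont (\<lambda>(c, x). smul c x) (c, x)"
    using continuous_scale by (simp add: continuous_on_eq_continuous_at)
  from isCont_tendsto_compose[OF this tendsto_Pair[OF assms]] show ?thesis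
    by simp
qed

lemma continuous_on_scale: "continuous_on A (smul c)"
  unfolding continuous_on_def by (intro ballI tendsto_scale tendsto_intros)

lemma linear_scale: "Vector_Spaces.linear smul smul (smul c)"
  by (rule linearI) (simp_all add: scale_right_distrib scale_left_commute)

lemma continuously_invertible_scale:
  "c \<noteq> 0 \<Longrightarrow> continuously_invertible smul (smul c)"
  unfolding continuously_invertible_def
  by (intro exI[of _ "smul (inverse c)"] conjI linear_scale continuous_on_scale) simp_all

text \<open>Translation carries continuity from 0 to any point, since
  \<open>F y = F (y - x) + F x\<close>.\<close>

lemma continuous_on_linear_if_at_0:
  assumes F: "Vector_Spaces.linear smul smul F"
    and at_0: "\<And>W. open W \<Longrightarrow> 0 \<in> W \<Longrightarrow> \<exists>V. open V \<and> 0 \<in> V \<and> F ` V \<subseteq> W"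
  shows "continuous_on UNIV F"
proof -
  interpret F: Vector_Spaces.linear smul smul F by (rule F)
  have lim: "(F \<longlongrightarrow> 0) (nhds 0)"
    unfolding tendsto_def eventually_nhds
  proof (intro allI impI)
    fix W :: "'a set" assume "open W" "0 \<in> W"
    then obtain V where "open V" "0 \<in> V" "F ` V \<subseteq> W" using at_0 by blast
    then show "\<exists>V. open V \<and> 0 \<in> V \<and> (\<forall>x\<in>V. F x \<in> W)"
      by (intro exI[of _ V]) auto
  qed
  have "isCont F x" for x
  proof -
    have "((\<lambda>y. y - x) \<longlongrightarrow> x - x) (at x)"
      by (intro tendsto_intros)
    then have "((\<lambda>y. F (y - x)) \<longlongrightarrow> 0) (at x)"
      using filterlim_compose[OF lim] by simp
    then have "((\<lambda>y. F (y - x) + F x) \<longlongrightarrow> 0 + F x) (at x)"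
      by (intro tendsto_intros)
    then show ?thesis
      by (simp add: isCont_def F.diff)
  qed
  then show ?thesis
    by (simp add: continuous_at_imp_continuous_on)
qed

text \<open>Zero neighborhoods are absorbing because \<open>r x\<close> tends to 0 as
  \<open>r\<close> decreases to 0. This later extends convergence of the Neumann series from
  \<open>U\<close> to the whole space.\<close>

lemma scale_mem_zero_neighborhood:
  assumes "open U" "0 \<in> U"
  obtains r where "r > 0" "smul (complex_of_real r) x \<in> U"
proof -
  have "((\<lambda>r. smul (complex_of_real r) x) \<longlongrightarrow> smul (complex_of_real 0) x) (at_right 0)"
    by (intro tendsto_scale tendsto_intros)
  then have "\<forall>\<^sub>F r in at_right 0. smul (complex_of_real r) x \<in> U"
    using assms by (auto simp: tendsto_def)
  then have "\<forall>\<^sub>F r in at_right 0. smul (complex_of_real r) x \<in> U \<and> r > 0"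
    using eventually_at_right_less eventually_conj by blast
  then show thesis
    using that eventually_happens'[OF trivial_limit_at_right_real] by blast
qed

section \<open>Absolutely convex combinations\<close>

lemma absolutely_convex_combination_mem:
  assumes convex: "\<And>x y u v. x \<in> W \<Longrightarrow> y \<in> W \<Longrightarrow> 0 \<le> u \<Longrightarrow> 0 \<le> v \<Longrightarrow> u + v = 1 \<Longrightarrow>
      smul (complex_of_real u) x + smul (complex_of_real v) y \<in> W"
    and balanced: "\<And>c x. x \<in> W \<Longrightarrow> cmod c \<le> 1 \<Longrightarrow> smul c x \<in> W"
    and "0 \<in> W" and b: "\<And>i. i \<in> I \<Longrightarrow> b i \<in> W" and a: "(\<Sum>i\<in>I. cmod (a i)) \<le> 1"
  shows "(\<Sum>i\<in>I. smul (a i) (b i)) \<in> W"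
proof (cases "finite I")
  case True
  \<comment> \<open>The induction keeps the total weight outside as an exact factor of one element
    of \<open>W\<close>; balancedness then absorbs this factor, which is at most 1, at the
    end.\<close>
  then have "\<exists>w\<in>W. (\<Sum>i\<in>I. smul (a i) (b i)) = smul (complex_of_real (\<Sum>i\<in>I. cmod (a i))) w"
    using b
  proof (induction I rule: finite_induct)
    case empty
    with \<open>0 \<in> W\<close> show ?case by auto
  next
    case (insert j I)
    then obtain w where w: "w \<in> W"
      "(\<Sum>i\<in>I. smul (a i) (b i)) = smul (complex_of_real (\<Sum>i\<in>I. cmod (a i))) w" by auto
    define s where "s = (\<Sum>i\<in>I. cmod (a i))"
    define r where "r = cmod (a j) + s"
    have s: "s \<ge> 0" by (simp add: s_def sum_nonneg)
    have r: "r \<ge> 0" using s by (simp add: r_def)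
    show ?case
    proof (cases "r = 0")
      case True
      then have "a j = 0" "s = 0" using s by (auto simp: r_def add_nonneg_eq_0_iff)
      with insert w show ?thesis by (auto simp: s_def[symmetric])
    next
      case False
      \<comment> \<open>The phase \<open>sgn (a j)\<close> is moved into the vector by balancedness,
        which leaves the nonnegative weights \<open>cmod (a j) / r\<close> and \<open>s / r\<close>
        of sum 1 for convexity.\<close>
      define v where "v = smul (complex_of_real (cmod (a j) / r)) (smul (sgn (a j)) (b j))
          + smul (complex_of_real (s / r)) w"
      have "v \<in> W"
        unfolding v_def using insert.prems w s r False
        by (intro convex balanced) (auto simp: r_def norm_sgn add_divide_distrib[symmetric])
      moreover have "smul (complex_of_real r) v = smul (a j) (b j) + smul (complex_of_real s) w"
      proof -
        have "complex_of_real (cmod (a j)) * sgn (a j) = a j"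
          by (simp add: sgn_eq)
        then show ?thesis using False
          by (simp add: v_def scale_right_distrib)
      qed
      ultimately show ?thesis
        using insert.hyps w(2)
        by (intro bexI[of _ v]) (simp_all add: s_def[symmetric] r_def[symmetric]
              del: of_real_add of_real_sum)
    qed
  qed
  then show ?thesis
    using balanced a by (auto simp: sum_nonneg simp del: of_real_sum)
qed (use \<open>0 \<in> W\<close> in simp)

text \<open>The balanced core of a convex neighborhood inside \<open>U\<close> is convex and
  balanced, hence closed under these combinations, and it contains an open zero neighborhood by
  joint continuity of scalar multiplication at (0, 0).\<close>

lemma zero_neighborhood_absolutely_convex_combination:
  assumes "open U" "0 \<in> U"
  obtains N where "open N" "0 \<in> N"
    "\<And>(I :: nat set) a b. (\<And>i. i \<in> I \<Longrightarrow> b i \<in> N) \<Longrightarrow> (\<Sum>i\<in>I. cmod (a i)) \<le> 1 \<Longrightarrow>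
        (\<Sum>i\<in>I. smul (a i) (b i)) \<in> U"
proof -
  obtain V where V: "open V" "0 \<in> V" "V \<subseteq> U"
    and V_convex: "\<And>x y u v. x \<in> V \<Longrightarrow> y \<in> V \<Longrightarrow> 0 \<le> u \<Longrightarrow> 0 \<le> v \<Longrightarrow> u + v = 1 \<Longrightarrow>
              smul (complex_of_real u) x + smul (complex_of_real v) y \<in> V"
    using locally_convex[OF assms] by meson
  \<comment> \<open>The balanced core of \<open>V\<close>.\<close>
  define W where "W = {x. \<forall>c. cmod c \<le> 1 \<longrightarrow> smul c x \<in> V}"
  have "open ((\<lambda>(c, x). smul c x) -` V)"
    using continuous_scale V(1) by (simp add: open_vimage)
  moreover have "(0, 0) \<in> (\<lambda>(c, x). smul c x) -` V"
    using V(2) by simp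
  ultimately obtain D N where "open D" "open N" "(0, 0) \<in> D \<times> N"
      "D \<times> N \<subseteq> (\<lambda>(c, x). smul c x) -` V"
    by (rule open_prod_elim)
  then have DN: "open D" "open N" "0 \<in> D" "0 \<in> N"
      "\<And>c x. c \<in> D \<Longrightarrow> x \<in> N \<Longrightarrow> smul c x \<in> V"
    by auto
  then obtain e where e: "e > 0" "\<And>c. cmod c < e \<Longrightarrow> c \<in> D"
    by (metis dist_0_norm dist_commute open_dist)
  define d where "d = complex_of_real (e / 2)"
  have d: "d \<noteq> 0" "cmod d < e" using e by (auto simp: d_def)
  \<comment> \<open>This is \<open>d N\<close>. For \<open>x = d n\<close> and |c| \<le> 1 the
    product \<open>c x = (c d) n\<close> lies in \<open>V\<close>, because |c d| < e.\<close>
  define N' where "N' = smul (inverse d) -` N"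
  have "N' \<subseteq> W"
  proof
    fix x assume "x \<in> N'"
    then have x: "smul (inverse d) x \<in> N" by (simp add: N'_def)
    have "smul c x \<in> V" if "cmod c \<le> 1" for c
    proof -
      have "cmod (c * d) < e"
        using that d(2) mult_right_mono[of "cmod c" 1 "cmod d"]
        by (simp add: norm_mult del: mult_le_cancel_right1 mult_le_cancel_right2)
      then have "smul (c * d) (smul (inverse d) x) \<in> V"
        using DN(5) e(2) x by blast
      then show ?thesis using d(1) by (simp add: mult.assoc)
    qed
    then show "x \<in> W" by (simp add: W_def)
  qed
  moreover have "W \<subseteq> U"
  proof
    fix x assume "x \<in> W"
    then have "smul c x \<in> V" if "cmod c \<le> 1" for c
      using that by (simp add: W_def)
    from this[of 1] show "x \<in> U" using V(3) by auto
  qed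
  moreover have "(\<Sum>i\<in>I. smul (a i) (b i)) \<in> W"
    if "\<And>i. i \<in> I \<Longrightarrow> b i \<in> W" "(\<Sum>i\<in>I. cmod (a i)) \<le> 1" for I :: "nat set" and a b
  proof (rule absolutely_convex_combination_mem)
    fix x y u v assume *: "x \<in> W" "y \<in> W" "0 \<le> u" "0 \<le> v" "u + v = (1::real)"
    have "smul c (smul (complex_of_real u) x + smul (complex_of_real v) y) \<in> V"
      if "cmod c \<le> 1" for c
      using V_convex[of "smul c x" "smul c y" u v] * that
      by (simp add: W_def scale_right_distrib mult.commute)
    then show "smul (complex_of_real u) x + smul (complex_of_real v) y \<in> W"
      by (simp add: W_def)
  next
    fix c x assume "x \<in> W" "cmod c \<le> 1"
    then show "smul c x \<in> W"
      by (auto simp: W_def norm_mult mult_le_one)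
  qed (use that V in \<open>auto simp: W_def\<close>)
  moreover have "open N'"
    unfolding N'_def using DN(2) continuous_on_scale by (rule open_vimage)
  moreover have "0 \<in> N'" using DN by (simp add: N'_def)
  ultimately show thesis
    by (intro that[of N']) blast+
qed

text \<open>With \<open>B\<close> absorbed as \<open>t N\<close>, the factor \<open>t\<close> moves
  from the vectors to the coefficients, so their absolute sum may be as large as
  \<open>1 / t\<close>. The bound \<open>d\<close> depends only on \<open>B\<close> and
  \<open>U\<close>, which is the source of all later uniformity.\<close>

lemma vn_bounded_combination_mem:
  assumes "vn_bounded smul B" "open U" "0 \<in> U"
  obtains d where "d > 0"
    "\<And>(I :: nat set) a b. (\<And>i. i \<in> I \<Longrightarrow> b i \<in> B) \<Longrightarrow> (\<Sum>i\<in>I. cmod (a i)) \<le> d \<Longrightarrow>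
        (\<Sum>i\<in>I. smul (a i) (b i)) \<in> U"
proof -
  obtain N where N: "open N" "0 \<in> N"
    and comb: "\<And>(I :: nat set) a b. (\<And>i. i \<in> I \<Longrightarrow> b i \<in> N) \<Longrightarrow> (\<Sum>i\<in>I. cmod (a i)) \<le> 1 \<Longrightarrow>
        (\<Sum>i\<in>I. smul (a i) (b i)) \<in> U"
    by (rule zero_neighborhood_absolutely_convex_combination[OF assms(2,3)]) blast
  obtain t where t: "t > 0" "B \<subseteq> smul (complex_of_real t) ` N"
    using vn_boundedE[OF assms(1) N] .
  show thesis
  proof (rule that[of "1 / t"])
    show "1 / t > 0" using t by simp
  next
    fix I :: "nat set" and a b
    assume b: "\<And>i. i \<in> I \<Longrightarrow> b i \<in> B" and a: "(\<Sum>i\<in>I. cmod (a i)) \<le> 1 / t"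
    have "\<forall>i\<in>I. \<exists>n\<in>N. b i = smul (complex_of_real t) n"
      using b t by blast
    then obtain n where n: "\<And>i. i \<in> I \<Longrightarrow> n i \<in> N \<and> b i = smul (complex_of_real t) (n i)"
      by metis
    have "(\<Sum>i\<in>I. cmod (a i * complex_of_real t)) = (\<Sum>i\<in>I. cmod (a i)) * t"
      using t by (simp add: norm_mult sum_distrib_right)
    also have "\<dots> \<le> 1" using a t by (simp add: field_simps)
    finally have "(\<Sum>i\<in>I. smul (a i * complex_of_real t) (n i)) \<in> U"
      using n by (intro comb) auto
    also have "(\<Sum>i\<in>I. smul (a i * complex_of_real t) (n i)) = (\<Sum>i\<in>I. smul (a i) (b i))"
      using n by (intro sum.cong) auto
    finally show "(\<Sum>i\<in>I. smul (a i) (b i)) \<in> U" .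
  qed
qed

section \<open>Locally bounded operators\<close>

lemma continuous_on_locally_bounded_op:
  assumes T: "Vector_Spaces.linear smul smul T" and "locally_bounded_op smul T"
  shows "continuous_on UNIV T"
proof (rule continuous_on_linear_if_at_0[OF T])
  interpret T: Vector_Spaces.linear smul smul T by (rule T)
  fix W :: "'a set" assume W: "open W" "0 \<in> W"
  obtain U B where UB: "open U" "0 \<in> U" "vn_bounded smul B" "T ` U \<subseteq> B"
    using assms(2) unfolding locally_bounded_op_def by blast
  obtain t where t: "t > 0" "B \<subseteq> smul (complex_of_real t) ` W"
    using vn_boundedE[OF UB(3) W] .
  \<comment> \<open>This is \<open>U\<close> shrunk by \<open>1 / t\<close>, to cancel the factor
    \<open>t\<close> with which \<open>W\<close> absorbs \<open>B\<close>.\<close>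
  let ?V = "smul (complex_of_real t) -` U"
  have "open ?V"
    using UB(1) continuous_on_scale by (rule open_vimage)
  moreover have "T x \<in> W" if "x \<in> ?V" for x
  proof -
    have "T (smul (complex_of_real t) x) \<in> B" using that UB by auto
    then obtain w where "w \<in> W" "smul (complex_of_real t) (T x) = smul (complex_of_real t) w"
      using t by (auto simp: T.scale)
    then show ?thesis using t by simp
  qed
  ultimately show "\<exists>V. open V \<and> 0 \<in> V \<and> T ` V \<subseteq> W"
    using UB by (intro exI[of _ ?V]) auto
qed

lemma vn_bounded_image:
  assumes F: "Vector_Spaces.linear smul smul F" "continuous_on UNIV F" and B: "vn_bounded smul B"
  shows "vn_bounded smul (F ` B)"
  unfolding vn_bounded_def
proof (intro allI impI)
  interpret F: Vector_Spaces.linear smul smul F by (rule F(1))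
  fix V :: "'a set" assume V: "open V \<and> 0 \<in> V"
  then have "open (F -` V)" "0 \<in> F -` V"
    using F(2) by (auto simp: open_vimage)
  then obtain s where s: "s > 0" "\<forall>t>s. B \<subseteq> smul (complex_of_real t) ` (F -` V)"
    using B unfolding vn_bounded_def by blast
  have "F ` B \<subseteq> smul (complex_of_real t) ` V" if "t > s" for t
  proof (rule image_subsetI)
    fix x assume "x \<in> B"
    with s(2)[rule_format, OF that] obtain v where "x = smul (complex_of_real t) v" "F v \<in> V"
      by auto
    then show "F x \<in> smul (complex_of_real t) ` V" by (auto simp: F.scale)
  qed
  with s(1) show "\<exists>s>0. \<forall>t>s. F ` B \<subseteq> smul (complex_of_real t) ` V" by blast
qed

text \<open>The bounded set \<open>B\<close> stays and \<open>U\<close> is replaced by its preimage.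
  This makes \<open>T R\<close> locally bounded when the resolvent \<open>R\<close> is only known to
  be continuous.\<close>

lemma locally_bounded_op_compose_right:
  assumes "Vector_Spaces.linear smul smul F" "continuous_on UNIV F" "locally_bounded_op smul T"
  shows "locally_bounded_op smul (\<lambda>x. T (F x))"
proof -
  interpret F: Vector_Spaces.linear smul smul F by (rule assms(1))
  obtain U B where UB: "open U" "0 \<in> U" "vn_bounded smul B" "T ` U \<subseteq> B"
    using assms(3) unfolding locally_bounded_op_def by blast
  moreover have "open (F -` U)" using UB(1) assms(2) by (simp add: open_vimage)
  ultimately show ?thesis
    unfolding locally_bounded_op_def by (intro exI[of _ "F -` U"] exI[of _ B]) auto
qed

end

section \<open>Neumann series\<close>

context sequentially_complete_lcs
begin

lemma convergent_absolutely_summable_vn_bounded: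
  assumes B: "vn_bounded smul B" and b: "\<And>i. b i \<in> B" and a: "summable (\<lambda>i. cmod (a i))"
  shows "convergent (\<lambda>n. \<Sum>i<n. smul (a i) (b i))"
proof (rule Cauchy_imp_convergent, unfold Cauchy_iff_zero_neighborhoods, intro allI impI)
  fix U :: "'a set" assume U: "open U \<and> 0 \<in> U"
  have "continuous_on UNIV (uminus :: 'a \<Rightarrow> 'a)"
    by (rule continuous_on_minus[OF continuous_on_id])
  \<comment> \<open>Differences of partial sums occur with either sign, according to the order of
    \<open>n\<close> and \<open>m\<close>, so the neighborhood is made symmetric.\<close>
  then have "open (U \<inter> uminus -` U)" "0 \<in> U \<inter> uminus -` U"
    using U by (simp_all add: open_Int open_vimage)
  from vn_bounded_combination_mem[OF B this] obtain d where d: "d > 0"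
    and comb: "\<And>(I :: nat set) a b. (\<And>i. i \<in> I \<Longrightarrow> b i \<in> B) \<Longrightarrow> (\<Sum>i\<in>I. cmod (a i)) \<le> d \<Longrightarrow>
        (\<Sum>i\<in>I. smul (a i) (b i)) \<in> U \<inter> uminus -` U"
    by blast
  obtain N where N: "\<And>m n. m \<ge> N \<Longrightarrow> norm (\<Sum>i=m..<n. cmod (a i)) < d"
    using a d unfolding summable_Cauchy by blast
  have mem: "(\<Sum>i=m..<n. smul (a i) (b i)) \<in> U \<inter> uminus -` U" if "m \<ge> N" for m n
    using b N[OF that, of n] by (intro comb) auto
  have split: "(\<Sum>i<n. smul (a i) (b i)) - (\<Sum>i<m. smul (a i) (b i)) = (\<Sum>i=m..<n. smul (a i) (b i))"
    if "m \<le> n" for m n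
    using that sum_diff_nat_ivl[of 0 m n "\<lambda>i. smul (a i) (b i)"] by (simp add: lessThan_atLeast0)
  show "\<exists>N. \<forall>n\<ge>N. \<forall>m\<ge>N. (\<Sum>i<m. smul (a i) (b i)) - (\<Sum>i<n. smul (a i) (b i)) \<in> U"
  proof (intro exI[of _ N] allI impI)
    fix n m assume nm: "n \<ge> N" "m \<ge> N"
    show "(\<Sum>i<m. smul (a i) (b i)) - (\<Sum>i<n. smul (a i) (b i)) \<in> U"
    proof (cases "n \<le> m")
      case True
      with split[OF True] mem[OF nm(1), of m] show ?thesis by simp
    next
      case False
      then have "(\<Sum>i<m. smul (a i) (b i)) - (\<Sum>i<n. smul (a i) (b i)) = - (\<Sum>i=m..<n. smul (a i) (b i))"
        by (simp add: split[symmetric])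
      with mem[OF nm(2), of n] show ?thesis by simp
    qed
  qed
qed

text \<open>The inverse is \<open>I + G\<close>, where \<open>G\<close> sums the powers of
  \<open>A\<close> from the first one on. The same \<open>a\<close> and \<open>B\<close> serve for
  all \<open>u\<close> in \<open>U\<close>, which makes the partial sums small uniformly near 0 and
  \<open>G\<close> continuous.\<close>

lemma Neumann_series:
  assumes A: "Vector_Spaces.linear smul smul A" "continuous_on UNIV A"
    and U: "open U" "0 \<in> U" and B: "vn_bounded smul B"
    and a: "summable (\<lambda>i. cmod (a i))"
    and pow: "\<And>i u. u \<in> U \<Longrightarrow> (A ^^ Suc i) u \<in> smul (a i) ` B"
  shows "continuously_invertible smul (\<lambda>x. x - A x)"
proof -
  interpret A: Vector_Spaces.linear smul smul A by (rule A(1))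
  have pow_add: "(A ^^ i) (x + y) = (A ^^ i) x + (A ^^ i) y"
    and pow_scale: "(A ^^ i) (smul c x) = smul c ((A ^^ i) x)" for i c x y
    by (induction i) (simp_all add: A.add A.scale)
  \<comment> \<open>The term \<open>x\<close> itself is left out: \<open>U\<close> may be unbounded,
    so only the powers from \<open>A\<close> on are controlled by \<open>B\<close>.\<close>
  define P where "P n x = (\<Sum>i<n. (A ^^ Suc i) x)" for n x
  have P_add: "P n (x + y) = P n x + P n y"
    and P_scale: "P n (smul c x) = smul c (P n x)" for n c x y
    unfolding P_def by (simp_all only: pow_add pow_scale sum.distrib scale_sum_right)
  have P_U: "\<exists>b. (\<forall>i. b i \<in> B) \<and> (\<forall>n. P n u = (\<Sum>i<n. smul (a i) (b i)))" if "u \<in> U" for u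
  proof -
    have "\<forall>i. \<exists>b\<in>B. (A ^^ Suc i) u = smul (a i) b" using pow[OF that] by blast
    then obtain b where "\<And>i. b i \<in> B \<and> (A ^^ Suc i) u = smul (a i) (b i)" by metis
    then show ?thesis by (intro exI[of _ b]) (simp add: P_def del: funpow.simps)
  qed
  have "convergent (\<lambda>n. P n x)" for x
  proof -
    obtain r where r: "r > 0" "smul (complex_of_real r) x \<in> U"
      using scale_mem_zero_neighborhood[OF U] .
    obtain L where "(\<lambda>n. P n (smul (complex_of_real r) x)) \<longlonglongrightarrow> L"
      using P_U[OF r(2)] convergent_absolutely_summable_vn_bounded[OF B _ a]
      by (metis (no_types, lifting) ext convergent_def)
    then have "(\<lambda>n. smul (inverse (complex_of_real r)) (P n (smul (complex_of_real r) x)))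
        \<longlonglongrightarrow> smul (inverse (complex_of_real r)) L"
      by (intro tendsto_scale tendsto_intros)
    then show ?thesis using r by (auto simp: P_scale convergent_def)
  qed
  then obtain G where G: "\<And>x. (\<lambda>n. P n x) \<longlonglongrightarrow> G x"
    unfolding convergent_def by metis
  have G_linear: "Vector_Spaces.linear smul smul G"
  proof (rule linearI)
    show "G (x + y) = G x + G y" for x y
      using tendsto_add[OF G[of x] G[of y]] G[of "x + y"]
      by (auto simp: P_add intro: LIMSEQ_unique)
    show "G (smul c x) = smul c (G x)" for c x
      using tendsto_scale[OF tendsto_const G[of x], of c] G[of "smul c x"]
      by (auto simp: P_scale intro: LIMSEQ_unique)
  qed
  have G_continuous: "continuous_on UNIV G"
  proof (rule continuous_on_linear_if_at_0[OF G_linear])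
    fix W :: "'a set" assume W: "open W" "0 \<in> W"
    \<comment> \<open>A limit of points of an open set may leave it. Hence \<open>W\<close> is split
      into \<open>W1\<close> for a partial sum \<open>P n x\<close> and \<open>W2\<close> for the
      remainder \<open>G x - P n x\<close> at some large \<open>n\<close>.\<close>
    have "continuous_on UNIV (\<lambda>(x, y). x + y :: 'a)"
      unfolding case_prod_unfold by (intro continuous_on_add continuous_on_fst continuous_on_snd continuous_on_id)
    with W(1) have "open ((\<lambda>(x, y). x + y :: 'a) -` W)"
      by (rule open_vimage)
    moreover have "(0, 0) \<in> (\<lambda>(x, y). x + y :: 'a) -` W"
      using W(2) by simp
    ultimately obtain W1 W2 where "open W1" "open W2" "(0, 0) \<in> W1 \<times> W2"
        "W1 \<times> W2 \<subseteq> (\<lambda>(x, y). x + y) -` W"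
      by (rule open_prod_elim)
    then have W12: "open W1" "open W2" "0 \<in> W1" "0 \<in> W2"
        "\<And>x y. x \<in> W1 \<Longrightarrow> y \<in> W2 \<Longrightarrow> x + y \<in> W"
      by auto
    from vn_bounded_combination_mem[OF B W12(1,3)] obtain d where d: "d > 0"
      and comb: "\<And>(I :: nat set) a b. (\<And>i. i \<in> I \<Longrightarrow> b i \<in> B) \<Longrightarrow> (\<Sum>i\<in>I. cmod (a i)) \<le> d \<Longrightarrow>
        (\<Sum>i\<in>I. smul (a i) (b i)) \<in> W1"
      by blast
    \<comment> \<open>The added 1 keeps \<open>s\<close> positive even if all coefficients vanish.
      Scaling by \<open>d / s\<close> brings every partial sum of absolute coefficients below
      \<open>d\<close>.\<close>
    define s where "s = (\<Sum>i. cmod (a i)) + 1"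
    have s: "s > 0" "\<And>n. (\<Sum>i<n. cmod (a i)) \<le> s"
      using suminf_nonneg[OF a] sum_le_suminf[OF a, of "{..<_}"]
      by (auto simp: s_def add.commute add_increasing)
    let ?c = "complex_of_real (d / s)"
    let ?V = "smul (inverse ?c) -` U"
    have c: "?c \<noteq> 0" using d s by simp
    have "open ?V"
      using U(1) continuous_on_scale by (rule open_vimage)
    moreover have "G x \<in> W" if "x \<in> ?V" for x
    proof -
      define u where "u = smul (inverse ?c) x"
      have u: "u \<in> U" "x = smul ?c u" using that c by (auto simp: u_def)
      obtain b where b: "\<And>i. b i \<in> B" "\<And>n. P n u = (\<Sum>i<n. smul (a i) (b i))"
        using P_U[OF u(1)] by blast
      have P_W1: "P n x \<in> W1" for n
      proof -
        have "P n x = (\<Sum>i<n. smul (?c * a i) (b i))"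
          unfolding u(2) by (simp only: P_scale b(2) scale_sum_right scale_scale)
        moreover have "(\<Sum>i<n. cmod (?c * a i)) = (d / s) * (\<Sum>i<n. cmod (a i))"
          using d s(1) by (simp add: norm_mult norm_divide sum_distrib_left)
        moreover have "\<dots> \<le> (d / s) * s"
          using d s by (intro mult_left_mono) auto
        ultimately show ?thesis
          using b(1) s(1) by (simp only:) (rule comb, auto)
      qed
      have "(\<lambda>n. G x - P n x) \<longlonglongrightarrow> G x - G x"
        by (intro tendsto_intros G)
      then have "\<forall>\<^sub>F n in sequentially. G x - P n x \<in> W2"
        using W12 by (auto simp: tendsto_def)
      then obtain n where "G x - P n x \<in> W2"
        using eventually_happens'[OF sequentially_bot] by blast
      from W12(5)[OF P_W1[of n] this] show ?thesis by simp
    qed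
    ultimately show "\<exists>V. open V \<and> 0 \<in> V \<and> G ` V \<subseteq> W"
      using U by (intro exI[of _ ?V]) auto
  qed
  \<comment> \<open>Applying \<open>A\<close> on either side shifts the sum by one index. In the
    limit \<open>A G = G A = G - A\<close>, which is what makes \<open>I + G\<close> a two-sided
    inverse of \<open>I - A\<close>.\<close>
  have A_P: "A (P n x) = P (Suc n) x - A x" and P_A: "P n (A x) = P (Suc n) x - A x" for n x
  proof -
    have "P (Suc n) x = A x + (\<Sum>i<n. (A ^^ Suc (Suc i)) x)"
      unfolding P_def by (subst sum.lessThan_Suc_shift) simp
    moreover have "A (P n x) = (\<Sum>i<n. (A ^^ Suc (Suc i)) x)"
      by (simp add: P_def A.sum)
    moreover have "P n (A x) = (\<Sum>i<n. (A ^^ Suc (Suc i)) x)"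
      by (simp add: P_def funpow_swap1)
    ultimately show "A (P n x) = P (Suc n) x - A x" "P n (A x) = P (Suc n) x - A x"
      by simp_all
  qed
  have lim: "(\<lambda>n. P (Suc n) x - A x) \<longlonglongrightarrow> G x - A x" for x
    by (intro tendsto_intros LIMSEQ_Suc G)
  have A_G: "A (G x) = G x - A x" for x
  proof -
    have "(\<lambda>n. A (P n x)) \<longlonglongrightarrow> A (G x)"
      using A(2) by (intro isCont_tendsto_compose[OF _ G]) (simp add: continuous_on_eq_continuous_at)
    with lim[of x] show ?thesis by (auto simp: A_P intro: LIMSEQ_unique)
  qed
  have G_A: "G (A x) = G x - A x" for x
    using G[of "A x"] lim[of x] by (auto simp: P_A intro: LIMSEQ_unique)
  interpret G: Vector_Spaces.linear smul smul G by (rule G_linear)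
  show ?thesis
    unfolding continuously_invertible_def
  proof (intro exI[of _ "\<lambda>x. x + G x"] conjI allI)
    show "Vector_Spaces.linear smul smul (\<lambda>x. x + G x)"
      by (rule linearI) (simp_all add: G.add G.scale scale_right_distrib)
    show "continuous_on UNIV (\<lambda>x. x + G x)"
      by (intro continuous_intros G_continuous)
    show "(x - A x) + G (x - A x) = x" for x by (simp add: G.diff G_A)
    show "(x + G x) - A (x + G x) = x" for x by (simp add: A.add A_G)
  qed
qed

section \<open>Boundedness of the spectrum\<close>

lemma locally_bounded_op_resolvent_outside_disc:
  assumes T: "Vector_Spaces.linear smul smul T" and lb: "locally_bounded_op smul T"
  obtains M where "M > 0" "\<And>l. cmod l > M \<Longrightarrow> l \<in> resolvent_set smul T"
proof -
  interpret T: Vector_Spaces.linear smul smul T by (rule T)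
  obtain U B where UB: "open U" "0 \<in> U" "vn_bounded smul B" "T ` U \<subseteq> B"
    using lb unfolding locally_bounded_op_def by blast
  obtain M where M: "M > 0" "B \<subseteq> smul (complex_of_real M) ` U"
    using vn_boundedE[OF UB(3,1,2)] .
  \<comment> \<open>Each further application of \<open>T\<close> costs one factor \<open>M\<close>:
    an element of \<open>B\<close> is \<open>M v\<close> with \<open>v\<close> in \<open>U\<close>,
    and \<open>T v\<close> is again in \<open>B\<close>.\<close>
  have T_pow: "(T ^^ Suc i) u \<in> smul (complex_of_real M ^ i) ` B" if "u \<in> U" for i u
  proof (induction i)
    case 0
    then show ?case using UB that by auto
  next
    case (Suc i)
    then obtain b where "b \<in> B" "(T ^^ Suc i) u = smul (complex_of_real M ^ i) b" by blast
    moreover from this obtain v where "v \<in> U" "b = smul (complex_of_real M) v"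
      using M by blast
    ultimately have "(T ^^ Suc (Suc i)) u = smul (complex_of_real M ^ Suc i) (T v)"
      by (simp add: T.scale mult.commute)
    then show ?case using UB \<open>v \<in> U\<close> by blast
  qed
  show thesis
  proof (rule that[OF M(1)])
    fix l assume l: "cmod l > M"
    then have l0: "l \<noteq> 0" using M by auto
    define A where "A x = smul (inverse l) (T x)" for x
    have A_linear: "Vector_Spaces.linear smul smul A"
      unfolding A_def by (rule linearI) (simp_all add: T.add T.scale scale_right_distrib mult.commute)
    have A_continuous: "continuous_on UNIV A"
      unfolding A_def
      using continuous_on_compose2[OF continuous_on_scale continuous_on_locally_bounded_op[OF T lb]]
      by blast
    have A_pow: "(A ^^ i) u = smul (inverse l ^ i) ((T ^^ i) u)" for i u
      by (induction i) (simp_all add: A_def T.scale mult.commute)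
    \<comment> \<open>The factor of \<open>B\<close> in the power \<open>Suc i\<close> of
      \<open>T / l\<close>; its absolute values form a geometric sequence of ratio
      \<open>M / cmod l\<close> < 1.\<close>
    define a where "a i = inverse l ^ Suc i * complex_of_real M ^ i" for i
    have "cmod (a i) = inverse (cmod l) * (M * inverse (cmod l)) ^ i" for i
      using M by (simp add: a_def norm_mult norm_power norm_inverse power_mult_distrib mult_ac)
    moreover have "norm (M * inverse (cmod l)) < 1"
      using l M by (simp add: divide_inverse[symmetric] divide_less_eq)
    ultimately have "summable (\<lambda>i. cmod (a i))"
      by (simp add: summable_geometric summable_mult)
    moreover have "(A ^^ Suc i) u \<in> smul (a i) ` B" if "u \<in> U" for i u
    proof -
      from T_pow[OF that] obtain b where "b \<in> B" "(T ^^ Suc i) u = smul (complex_of_real M ^ i) b"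
        by blast
      then show ?thesis
        unfolding A_pow a_def by (metis imageI scale_scale)
    qed
    ultimately have "continuously_invertible smul (\<lambda>x. x - A x)"
      using Neumann_series[OF A_linear A_continuous UB(1,2,3)] by blast
    then have "continuously_invertible smul (\<lambda>x. smul l (x - A x))"
      by (rule continuously_invertible_compose[OF continuously_invertible_scale[OF l0]])
    moreover have "smul l (x - A x) = smul l x - T x" for x
      using l0 by (simp add: A_def scale_right_diff_distrib)
    ultimately show "l \<in> resolvent_set smul T"
      by (simp add: resolvent_set_iff)
  qed
qed

section \<open>Openness of the resolvent set\<close>

text \<open>The resolvent at 0 satisfies \<open>R T = - I\<close>, hence \<open>R = - R R T\<close>.
  So \<open>R\<close> maps \<open>U\<close> into the image of \<open>B\<close> under
  \<open>- R R\<close>, which is bounded by continuity.\<close>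

lemma locally_bounded_op_uminus_left_inverse:
  assumes lb: "locally_bounded_op smul T"
    and R: "Vector_Spaces.linear smul smul R" "continuous_on UNIV R" "\<And>x. R (T x) = - x"
  shows "locally_bounded_op smul R"
proof -
  interpret R: Vector_Spaces.linear smul smul R by (rule R(1))
  obtain U B where UB: "open U" "0 \<in> U" "vn_bounded smul B" "T ` U \<subseteq> B"
    using lb unfolding locally_bounded_op_def by blast
  have "vn_bounded smul ((\<lambda>x. - R x) ` R ` B)"
  proof (intro vn_bounded_image UB R)
    show "Vector_Spaces.linear smul smul (\<lambda>x. - R x)"
      by (rule linearI) (simp_all add: R.add R.scale)
    show "continuous_on UNIV (\<lambda>x. - R x)"
      by (intro continuous_intros R)
  qed
  moreover have "R ` U \<subseteq> (\<lambda>x. - R x) ` R ` B"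
  proof (rule image_subsetI)
    fix u assume "u \<in> U"
    then have "T u \<in> B" using UB by auto
    moreover have "R u = - R (R (T u))" by (simp add: R R.neg)
    ultimately show "R u \<in> (\<lambda>x. - R x) ` R ` B" by blast
  qed
  ultimately show ?thesis
    unfolding locally_bounded_op_def using UB(1,2) by blast
qed

text \<open>In both cases \<open>I + (l - l0) R\<close> is written as \<open>k (z I - K)\<close>
  with \<open>K\<close> locally bounded and independent of \<open>l\<close>, where |z| grows without
  bound as \<open>l\<close> approaches \<open>l0\<close>. Invertibility then follows from the result
  outside a disc, applied to \<open>K\<close>.\<close>

lemma open_resolvent_set:
  assumes T: "Vector_Spaces.linear smul smul T" and lb: "locally_bounded_op smul T"
  shows "open (resolvent_set smul T)"
  unfolding open_dist
proof (intro ballI)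
  interpret T: Vector_Spaces.linear smul smul T by (rule T)
  fix l0 assume l0: "l0 \<in> resolvent_set smul T"
  then obtain R where "Vector_Spaces.linear smul smul R \<and> continuous_on UNIV R \<and>
    (\<forall>x. R (smul l0 x - T x) = x) \<and> (\<forall>x. smul l0 (R x) - T (R x) = x)"
    unfolding resolvent_set_def mem_Collect_eq ..
  then have R: "Vector_Spaces.linear smul smul R" "continuous_on UNIV R"
    "\<And>x. R (smul l0 x - T x) = x" "\<And>x. smul l0 (R x) - T (R x) = x"
    by simp_all
  interpret R: Vector_Spaces.linear smul smul R by (rule R(1))
  \<comment> \<open>Rests on \<open>l I - T = (l0 I - T) (I + (l - l0) R)\<close>, a product of two
    invertible factors.\<close>
  have perturb: "l \<in> resolvent_set smul T"
    if "k \<noteq> 0" "z \<in> resolvent_set smul K" "\<And>x. x + smul (l - l0) (R x) = smul k (smul z x - K x)"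
    for l k z K
  proof -
    have "continuously_invertible smul (\<lambda>x. x + smul (l - l0) (R x))"
      unfolding that(3) using that(2) unfolding resolvent_set_iff
      by (rule continuously_invertible_compose[OF continuously_invertible_scale[OF that(1)]])
    with l0 have "continuously_invertible smul
        (\<lambda>x. smul l0 (x + smul (l - l0) (R x)) - T (x + smul (l - l0) (R x)))"
      unfolding resolvent_set_iff by (rule continuously_invertible_compose)
    moreover have "smul l0 (x + smul (l - l0) (R x)) - T (x + smul (l - l0) (R x)) = smul l x - T x" for x
    proof -
      have "smul l0 (x + smul (l - l0) (R x)) - T (x + smul (l - l0) (R x))
          = smul l0 x - T x + smul (l - l0) (smul l0 (R x) - T (R x))"
        by (simp add: T.add T.scale scale_right_distrib scale_right_diff_distrib
            scale_left_commute)
      then show ?thesis by (simp add: R(4) scale_left_diff_distrib)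
    qed
    ultimately show ?thesis by (simp add: resolvent_set_iff)
  qed
  have neg: "Vector_Spaces.linear smul smul (\<lambda>x. - R x)" "continuous_on UNIV (\<lambda>x. - R x)"
    using R(2) by (auto intro!: linearI continuous_on_minus simp: R.add R.scale)
  show "\<exists>e>0. \<forall>l. dist l l0 < e \<longrightarrow> l \<in> resolvent_set smul T"
  proof (cases "l0 = 0")
    case True
    then have "R (T x) = - x" for x
      using R(3)[of x] by (simp add: R.neg minus_equation_iff)
    then have "locally_bounded_op smul R"
      by (rule locally_bounded_op_uminus_left_inverse[OF lb R(1,2)])
    from locally_bounded_op_compose_right[OF linear_scale continuous_on_scale this, of "-1"]
    have "locally_bounded_op smul (\<lambda>x. - R x)"
      by (simp add: R.neg)
    from locally_bounded_op_resolvent_outside_disc[OF neg(1) this]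
    obtain M where M: "M > 0" "\<And>z. cmod z > M \<Longrightarrow> z \<in> resolvent_set smul (\<lambda>x. - R x)" by blast
    have "l \<in> resolvent_set smul T" if "cmod l < 1 / M" for l
    proof (cases "l = 0")
      case False
      with that M have "cmod (1 / l) > M" by (simp add: norm_divide field_simps)
      \<comment> \<open>Here \<open>I + l R = l ((1 / l) I - (- R))\<close>.\<close>
      with False show ?thesis
        by (intro perturb[of l "1 / l" "\<lambda>x. - R x"] M(2))
          (simp_all add: True scale_right_distrib)
    qed (use l0 True in simp)
    then show ?thesis using M(1) True by (intro exI[of _ "1 / M"]) auto
  next
    case False
    \<comment> \<open>The sign is chosen so that \<open>z I - K = z I + T R\<close>.\<close>
    define K where "K x = T (- R x)" for x
    have "Vector_Spaces.linear smul smul K" "locally_bounded_op smul K"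
      unfolding K_def using Vector_Spaces.linear_compose[OF neg(1) T] locally_bounded_op_compose_right[OF neg lb]
      by (simp_all add: o_def)
    from locally_bounded_op_resolvent_outside_disc[OF this]
    obtain M where M: "M > 0" "\<And>z. cmod z > M \<Longrightarrow> z \<in> resolvent_set smul K" by blast
    \<comment> \<open>The radius yields |l - l0| (M + 1) < |l0| \<le> |l| + |l - l0|, hence |l| > M
      |l - l0|, so \<open>z = l / (l - l0)\<close> lies outside the disc for
      \<open>K\<close>.\<close>
    have "l \<in> resolvent_set smul T" if "cmod (l - l0) < cmod l0 / (M + 1)" for l
    proof (cases "l = l0")
      case ne: False
      have "cmod (l - l0) * (M + 1) < cmod l0"
        using that M by (simp add: field_simps)
      moreover have "cmod l0 \<le> cmod l + cmod (l - l0)"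
        by (metis norm_triangle_sub norm_minus_commute)
      ultimately have "cmod (l / (l - l0)) > M"
        using ne by (simp add: norm_divide field_simps)
      moreover have "x + smul (l - l0) (R x)
          = smul ((l - l0) / l0) (smul (l / (l - l0)) x - K x)" for x
      proof -
        have TR: "T (R x) = smul l0 (R x) - x"
          using R(4)[of x] by (metis add_diff_cancel_left' diff_add_cancel)
        have KR: "smul ((l - l0) / l0) (T (R x)) = smul (l - l0) (R x) - smul ((l - l0) / l0) x"
          using False by (simp add: TR scale_right_diff_distrib)
        have "smul ((l - l0) / l0) (smul (l / (l - l0)) x - K x)
            = smul (l / l0) x + smul ((l - l0) / l0) (T (R x))"
          using ne False by (simp add: K_def T.neg scale_right_distrib)
        also have "\<dots> = smul (l / l0 - (l - l0) / l0) x + smul (l - l0) (R x)"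
          by (simp only: KR scale_left_diff_distrib[of "l / l0"] add_diff_eq diff_add_eq)
        also have "l / l0 - (l - l0) / l0 = 1"
          using False by (simp add: field_simps)
        finally show ?thesis by simp
      qed
      ultimately show ?thesis
        using ne False by (intro perturb[of "(l - l0) / l0" "l / (l - l0)" K] M(2)) auto
    qed (use l0 in simp)
    then show ?thesis
      using M(1) False by (intro exI[of _ "cmod l0 / (M + 1)"]) (auto simp: dist_norm)
  qed
qed

section \<open>Compactness of the spectrum\<close>

lemma compact_spectral_set:
  assumes "Vector_Spaces.linear smul smul T" "locally_bounded_op smul T"
  shows "compact (spectral_set smul T)"
proof (rule locally_bounded_op_resolvent_outside_disc[OF assms])
  fix M assume "\<And>l. cmod l > M \<Longrightarrow> l \<in> resolvent_set smul T"
  then have "bounded (spectral_set smul T)"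
    unfolding spectral_set_def bounded_iff by (intro exI[of _ M] ballI leI) auto
  moreover have "closed (spectral_set smul T)"
    unfolding spectral_set_def closed_def using open_resolvent_set[OF assms] by simp
  ultimately show ?thesis
    by (simp add: compact_eq_bounded_closed)
qed

end

theorem theorem3p15:
  fixes smul :: "complex \<Rightarrow> 'a::{uniform_topological_group_add, ab_group_add, t2_space} \<Rightarrow> 'a"
    and T :: "'a \<Rightarrow> 'a"
  assumes "sequentially_complete_lcs smul"
    and "Vector_Spaces.linear smul smul T"
    and "locally_bounded_op smul T"
  shows "compact (spectral_set smul T)"
  using assms by (rule sequentially_complete_lcs.compact_spectral_set)

end
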